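(* Let $X$ be a nonempty set. For every predicate $P$ on $X$ and every nonempty subset $Y\subset X$, $$\mathfrak{UM}(P|_Y)=\{[\phi\,|\,Y]:\phi\in\mathfrak{UM}(P)\}.$$
   Context: $\mathcal P(Z)$ is the power set of $Z$. A predicate on a nonempty set $Z$ is a function $Q:Z\to\{0,1\}$, with truth set $Q^{-1}(1)=\{z\in Z\mid Q(z)=1\}$. For a multifunction $f:Z\to\mathcal P(Z)$, $\mathbf{Fix}(f)=\{z\in Z\mid z\in f(z)\}$. For a predicate $Q$ on $Z$, $\mathfrak{UM}(Q)$ is the set of all $f:Z\to\mathcal P(Z)$ with $\mathbf{Fix}(f)=Q^{-1}(1)$. $P|_Y$ is the restriction of $P$ to $Y$, a predicate on $Y$ (so $\mathfrak{UM}(P|_Y)$ consists of multifunctions $Y\to\mathcal P(Y)$). For $\phi:X\to\mathcal P(X)$, the multifunction $[\phi\,|\,Y]:Y\to\mathcal P(Y)$ is $[\phi\,|\,Y](y)=Y\cap\phi(y)$ for $y\in Y$. *)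

theory Defs
  imports Main "HOL-Library.FuncSet"
begin

text \<open>Functions with domain a set \<open>Z\<close> are represented as extensional functions
  (value \<open>undefined\<close> outside \<open>Z\<close>), so that HOL equality of their representations
  is equality of functions on \<open>Z\<close>.\<close>

definition predicates :: "'a set \<Rightarrow> ('a \<Rightarrow> nat) set" where
  "predicates Z = Z \<rightarrow>\<^sub>E {0, 1}"

definition truth_set :: "'a set \<Rightarrow> ('a \<Rightarrow> nat) \<Rightarrow> 'a set" where
  "truth_set Z Q = {z \<in> Z. Q z = 1}"

definition multifunctions :: "'a set \<Rightarrow> ('a \<Rightarrow> 'a set) set" where
  "multifunctions Z = Z \<rightarrow>\<^sub>E Pow Z"

definition Fix :: "'a set \<Rightarrow> ('a \<Rightarrow> 'a set) \<Rightarrow> 'a set" where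
  "Fix Z f = {z \<in> Z. z \<in> f z}"

definition UM :: "'a set \<Rightarrow> ('a \<Rightarrow> nat) \<Rightarrow> ('a \<Rightarrow> 'a set) set" where
  "UM Z Q = {f \<in> multifunctions Z. Fix Z f = truth_set Z Q}"

text \<open>The multifunction \<open>[\<phi> | Y]\<close>.\<close>

definition trace_on :: "('a \<Rightarrow> 'a set) \<Rightarrow> 'a set \<Rightarrow> 'a \<Rightarrow> 'a set" where
  "trace_on \<phi> Y = (\<lambda>y\<in>Y. Y \<inter> \<phi> y)"

end

theory Submission
  imports Defs
begin

text \<open>
  Whether a point \<open>y\<close> of \<open>Y\<close> is fixed is a matter of the value at \<open>y\<close> alone, and
  intersecting that value with \<open>Y\<close> neither adds nor removes \<open>y\<close> itself. Hence a trace on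
  \<open>Y\<close> has exactly the fixed points of the original multifunction that lie in \<open>Y\<close>, which
  gives one inclusion.
  For the other, a multifunction \<open>f\<close> on \<open>Y\<close> already takes values in \<open>Pow Y \<subseteq> Pow X\<close>, so
  it can be kept on \<open>Y\<close> and extended to \<open>X\<close> by arbitrary values, and its trace is \<open>f\<close>
  again. The constant value \<open>truth_set X P\<close> on \<open>X - Y\<close> contains a point \<open>x\<close> exactly when
  \<open>P x = 1\<close>, so with this choice the extension has the required fixed points.
\<close>

lemma Fix_trace_on:
  assumes "Y \<subseteq> X"
  shows "Fix Y (trace_on \<phi> Y) = Y \<inter> Fix X \<phi>"
  using assms by (auto simp: Fix_def trace_on_def)

lemma truth_set_restrict:
  assumes "Y \<subseteq> X"
  shows "truth_set Y (restrict P Y) = Y \<inter> truth_set X P"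
  using assms by (auto simp: truth_set_def)

lemma trace_on_in_UM:
  assumes "Y \<subseteq> X" and "\<phi> \<in> UM X P"
  shows "trace_on \<phi> Y \<in> UM Y (restrict P Y)"
proof -
  have "trace_on \<phi> Y \<in> multifunctions Y"
    by (auto simp: multifunctions_def trace_on_def)
  moreover have "Fix X \<phi> = truth_set X P"
    using assms(2) by (simp add: UM_def)
  ultimately show ?thesis
    by (simp add: UM_def Fix_trace_on[OF assms(1)] truth_set_restrict[OF assms(1)])
qed

definition extend_by_truth_set ::
    "'a set \<Rightarrow> ('a \<Rightarrow> nat) \<Rightarrow> 'a set \<Rightarrow> ('a \<Rightarrow> 'a set) \<Rightarrow> 'a \<Rightarrow> 'a set" where
  "extend_by_truth_set X P Y f = (\<lambda>x\<in>X. if x \<in> Y then f x else truth_set X P)"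

lemma trace_on_extend_by_truth_set:
  assumes "Y \<subseteq> X" and "f \<in> multifunctions Y"
  shows "trace_on (extend_by_truth_set X P Y f) Y = f"
proof (rule extensionalityI[where A = Y])
  show "trace_on (extend_by_truth_set X P Y f) Y \<in> extensional Y"
    by (simp add: trace_on_def)
  show "f \<in> extensional Y"
    using assms(2) by (auto simp: multifunctions_def PiE_def)
  fix y assume "y \<in> Y"
  then have "f y \<subseteq> Y"
    using assms(2) by (auto simp: multifunctions_def)
  then show "trace_on (extend_by_truth_set X P Y f) Y y = f y"
    using \<open>y \<in> Y\<close> assms(1) by (auto simp: trace_on_def extend_by_truth_set_def)
qed

lemma extend_by_truth_set_in_UM:
  assumes "Y \<subseteq> X" and "f \<in> UM Y (restrict P Y)"
  shows "extend_by_truth_set X P Y f \<in> UM X P"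
proof -
  let ?\<phi> = "extend_by_truth_set X P Y f"
  have f: "f \<in> multifunctions Y" and fix_f: "Fix Y f = Y \<inter> truth_set X P"
    using assms(2) by (auto simp: UM_def truth_set_restrict[OF assms(1)])
  have "f y \<subseteq> X" if "y \<in> Y" for y
    using f that assms(1) by (auto simp: multifunctions_def)
  then have "?\<phi> \<in> multifunctions X"
    by (auto simp: multifunctions_def extend_by_truth_set_def truth_set_def)
  moreover have "Fix X ?\<phi> = truth_set X P"
  proof -
    have "Y \<inter> Fix X ?\<phi> = Y \<inter> truth_set X P"
      using Fix_trace_on[OF assms(1), of ?\<phi>] trace_on_extend_by_truth_set[OF assms(1) f] fix_f
      by metis
    moreover have "Fix X ?\<phi> - Y = truth_set X P - Y"
      by (auto simp: Fix_def extend_by_truth_set_def truth_set_def)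
    ultimately show ?thesis
      by blast
  qed
  ultimately show ?thesis
    by (simp add: UM_def)
qed

theorem lemma3p2:
  fixes X Y :: "'a set" and P :: "'a \<Rightarrow> nat"
  assumes "X \<noteq> {}"
    and "P \<in> predicates X"
    and "Y \<subseteq> X" and "Y \<noteq> {}"
  shows "UM Y (restrict P Y) = {trace_on \<phi> Y | \<phi>. \<phi> \<in> UM X P}"
proof
  show "{trace_on \<phi> Y | \<phi>. \<phi> \<in> UM X P} \<subseteq> UM Y (restrict P Y)"
    using trace_on_in_UM[OF assms(3)] by auto
  show "UM Y (restrict P Y) \<subseteq> {trace_on \<phi> Y | \<phi>. \<phi> \<in> UM X P}"
  proof
    fix f assume f: "f \<in> UM Y (restrict P Y)"
    then have "f = trace_on (extend_by_truth_set X P Y f) Y"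
      using trace_on_extend_by_truth_set[OF assms(3)] by (simp add: UM_def)
    then show "f \<in> {trace_on \<phi> Y | \<phi>. \<phi> \<in> UM X P}"
      using extend_by_truth_set_in_UM[OF assms(3) f] by blast
  qed
qed

end
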